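(* Let $\lambda>0$, let $\mathcal{K}:\mathbb{R}^p\times\mathbb{R}^p\to\mathbb{R}$ be a positive-definite kernel with feature map $\phi:\mathbb{R}^p\to H$ into a real Hilbert space $H$, so that $\mathcal{K}(x,x')=\langle\phi(x),\phi(x')\rangle_H$. Let $N\ge 2$, and for each $i=1,\dots,N$ let $\mathbf{X}_e^{(i)}\in\mathbb{R}^{N_i\times p}$ be the feature matrix and $\mathbf{Y}^{(i)}\in\{0,1\}^{N_i\times c_i}$ the one-hot label matrix of the $i$-th domain, where the label sets of different domains are disjoint. Define $\mathbf{M}_d^{(1)}=\mathbf{X}_e^{(1)}$, $\mathbf{K}^{(1)}=\mathcal{K}(\mathbf{X}_e^{(1)},\mathbf{X}_e^{(1)})$, $\mathbf{C}^{(1)}=\mathbf{Y}^{(1)}$, and for $2\le n\le N$ define recursively $$\mathbf{K}^{(n)}=\begin{bmatrix}\mathbf{K}^{(n-1)} & \mathcal{K}\left(\mathbf{X}_e^{(n)},\mathbf{M}_d^{(n-1)}\right)^\top\\ \mathcal{K}\left(\mathbf{X}_e^{(n)},\mathbf{M}_d^{(n-1)}\right) & \mathcal{K}\left(\mathbf{X}_e^{(n)},\mathbf{X}_e^{(n)}\right)\end{bmatrix},\qquad \mathbf{C}^{(n)}=\begin{bmatrix}\mathbf{C}^{(n-1)} & \mathbf{0}\\ \mathbf{0} & \mathbf{Y}^{(n)}\end{bmatrix},$$ $$\mathbf{M}_d^{(n)}=\begin{bmatrix}\mathbf{M}_d^{(n-1)\top} & \mathbf{X}_e^{(n)\top}\end{bmatrix}^\top.$$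 Then for every $2\le n\le N$ the parameter $$\boldsymbol{\alpha}^{(n)}=\left(\mathbf{K}^{(n)}+\lambda\mathbf{I}\right)^{-1}\mathbf{C}^{(n)}$$ is an optimal (dual) solution of the joint training problem on all first $n$ domains; that is, $\mathbf{W}^{(n)}=\mathbf{\Phi}^{(1:n)\top}\boldsymbol{\alpha}^{(n)}$ minimizes $$\left\|\mathbf{Y}^{(1:n)}-\mathbf{\Phi}^{(1:n)}\mathbf{W}\right\|_F^2+\lambda\left\|\mathbf{W}\right\|_F^2$$ over all $\mathbf{W}=(w_1,\dots,w_c)\in H^{c}$, where $c=c_1+\cdots+c_n$.
   Context: Domains $1,\dots,N$ arrive sequentially. Domain $i$ has $N_i$ training samples, whose features (produced by a fixed image encoder) form the rows of $\mathbf{X}_e^{(i)}\in\mathbb{R}^{N_i\times p}$; each row of $\mathbf{Y}^{(i)}$ is the one-hot encoding of the sample's class among the $c_i$ classes of domain $i$. For matrices $A\in\mathbb{R}^{a\times p}$, $B\in\mathbb{R}^{b\times p}$ with rows $A_j$, $B_k$, $\mathcal{K}(A,B)\in\mathbb{R}^{a\times b}$ is the matrix with entries $\mathcal{K}(A_j,B_k)$. Positive-definite kernel means symmetric with all Gram matrices $\mathcal{K}(A,A)$ positive semidefinite (equivalently, admitting a feature map $\phi$ as in the claim). Joint data for the first $n$ domains: $\mathbf{X}_e^{(1:n)}$ is the vertical concatenation of $\mathbf{X}_e^{(1)},\dots,\mathbf{X}_e^{(n)}$, with rows $x_1,\dots,x_m$, $m=N_1+\cdots+N_n$. Because the label sets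 of different domains are disjoint, $\mathbf{Y}^{(1:n)}$ is the block-diagonal matrix $\mathrm{diag}(\mathbf{Y}^{(1)},\dots,\mathbf{Y}^{(n)})\in\mathbb{R}^{m\times c}$. The matrix $\mathbf{\Phi}^{(1:n)}=\phi(\mathbf{X}_e^{(1:n)})$ has "rows" $\phi(x_1),\dots,\phi(x_m)\in H$: for $\mathbf{W}=(w_1,\dots,w_c)\in H^c$ (columns $w_k\in H$), $\mathbf{\Phi}^{(1:n)}\mathbf{W}\in\mathbb{R}^{m\times c}$ has entries $\langle\phi(x_j),w_k\rangle_H$, and for $\boldsymbol{\alpha}\in\mathbb{R}^{m\times c}$, $\mathbf{\Phi}^{(1:n)\top}\boldsymbol{\alpha}\in H^c$ has $k$-th column $\sum_{j=1}^m\alpha_{jk}\phi(x_j)$. $\|\mathbf{W}\|_F^2=\sum_k\|w_k\|_H^2$, and $\|\cdot\|_F$ on real matrices is the Frobenius norm. A matrix $\boldsymbol{\alpha}\in\mathbb{R}^{m\times c}$ is called a dual parameter, representing the primal parameter $\mathbf{W}=\mathbf{\Phi}^{(1:n)\top}\boldsymbol{\alpha}$. $\mathbf{I}$ is the identity matrix of the appropriate size. *)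

theory Defs
  imports
    "HOL-Analysis.Inner_Product"
    "HOL-Library.Disjoint_Sets"
    "Jordan_Normal_Form.Gauss_Jordan_Elimination"
begin

definition kernel_mat ::
  "(real vec \<Rightarrow> real vec \<Rightarrow> real) \<Rightarrow> real mat \<Rightarrow> real mat \<Rightarrow> real mat" where
  "kernel_mat k A B = mat (dim_row A) (dim_row B) (\<lambda>(i, j). k (row A i) (row B j))"

definition pos_semidef_mat :: "real mat \<Rightarrow> bool" where
  "pos_semidef_mat G \<longleftrightarrow> square_mat G \<and> transpose_mat G = G \<and>
     (\<forall>v \<in> carrier_vec (dim_row G). 0 \<le> v \<bullet> (G *\<^sub>v v))"

(* The kernel is only constrained on vectors of dimension p, since the type of vectors
   contains all dimensions. *)
definition pos_def_kernel :: "nat \<Rightarrow> (real vec \<Rightarrow> real vec \<Rightarrow> real) \<Rightarrow> bool" where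
  "pos_def_kernel p k \<longleftrightarrow>
     (\<forall>x \<in> carrier_vec p. \<forall>y \<in> carrier_vec p. k x y = k y x) \<and>
     (\<forall>a. \<forall>A \<in> carrier_mat a p. pos_semidef_mat (kernel_mat k A A))"

(* cls lists the classes in column order, labs the classes of the successive samples. *)
definition one_hot_mat :: "'l list \<Rightarrow> 'l list \<Rightarrow> real mat" where
  "one_hot_mat cls labs =
     mat (length labs) (length cls) (\<lambda>(j, k). if labs ! j = cls ! k then 1 else 0)"

definition joint_features :: "nat \<Rightarrow> (nat \<Rightarrow> real mat) \<Rightarrow> nat \<Rightarrow> real mat" where
  "joint_features p X n = mat_of_rows p (concat (map (\<lambda>i. rows (X i)) [1..<Suc n]))"

definition joint_labels :: "(nat \<Rightarrow> real mat) \<Rightarrow> nat \<Rightarrow> real mat" where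
  "joint_labels Y n = diag_block_mat (map Y [1..<Suc n])"

(* A matrix with "rows" in H is the vector of these rows; an element (w_1, ..., w_c) of H^c
   is a vector with entries in H. *)
definition feature_rows :: "(real vec \<Rightarrow> 'h) \<Rightarrow> real mat \<Rightarrow> 'h vec" where
  "feature_rows \<phi> X = vec (dim_row X) (\<lambda>j. \<phi> (row X j))"

definition feature_mult :: "'h::real_inner vec \<Rightarrow> 'h vec \<Rightarrow> real mat" where
  "feature_mult F W = mat (dim_vec F) (dim_vec W) (\<lambda>(j, k). inner (F $ j) (W $ k))"

definition feature_transpose_mult :: "'h::real_vector vec \<Rightarrow> real mat \<Rightarrow> 'h vec" where
  "feature_transpose_mult F \<alpha> =
     vec (dim_col \<alpha>) (\<lambda>k. \<Sum>j<dim_vec F. \<alpha> $$ (j, k) *\<^sub>R (F $ j))"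

definition frobenius_norm :: "real mat \<Rightarrow> real" where
  "frobenius_norm A = sqrt (\<Sum>i<dim_row A. \<Sum>j<dim_col A. (A $$ (i, j))\<^sup>2)"

definition frobenius_norm_vec :: "'h::real_normed_vector vec \<Rightarrow> real" where
  "frobenius_norm_vec W = sqrt (\<Sum>k<dim_vec W. (norm (W $ k))\<^sup>2)"

definition ridge_objective :: "real \<Rightarrow> real mat \<Rightarrow> 'h::real_inner vec \<Rightarrow> 'h vec \<Rightarrow> real" where
  "ridge_objective lam Y F W =
     (frobenius_norm (Y - feature_mult F W))\<^sup>2 + lam * (frobenius_norm_vec W)\<^sup>2"

lemma one_hot_mat_append:
  assumes "set xs \<inter> set ys = {}" "set as \<subseteq> set xs" "set bs \<subseteq> set ys"
  shows "one_hot_mat (xs @ ys) (as @ bs) =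
    four_block_mat (one_hot_mat xs as) (0\<^sub>m (length as) (length ys))
      (0\<^sub>m (length bs) (length xs)) (one_hot_mat ys bs)"
proof (rule eq_matI, goal_cases)
  case (1 i j)
  have ij: "i < length as + length bs" "j < length xs + length ys"
    using 1 by (auto simp: one_hot_mat_def)
  have a: "as ! i \<in> set xs" if "i < length as" using that assms(2) by auto
  have b: "bs ! (i - length as) \<in> set ys" if "\<not> i < length as"
  proof -
    have "i - length as < length bs" using that ij by linarith
    then show ?thesis using nth_mem assms(3) by blast
  qed
  have x: "xs ! j \<in> set xs" if "j < length xs" using that by auto
  have y: "ys ! (j - length xs) \<in> set ys" if "\<not> j < length xs" using that ij by auto
  have "u \<noteq> v" if "u \<in> set xs" "v \<in> set ys" for u v
    using that assms(1) by blast
  note ne = this this[symmetric]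
  show ?case
    using ij a b x y ne
    by (cases "i < length as"; cases "j < length xs") (auto simp: one_hot_mat_def nth_append)
qed (auto simp: one_hot_mat_def)

(* For pairwise disjoint label sets, joint_labels is the one-hot encoding of all samples
   with respect to the concatenated list of classes. *)
lemma one_hot_mat_concat:
  assumes "distinct is" "disjoint_family_on (\<lambda>i. set (cls i)) (set is)"
    and "\<And>i. i \<in> set is \<Longrightarrow> set (labs i) \<subseteq> set (cls i)"
  shows "one_hot_mat (concat (map cls is)) (concat (map labs is)) =
    diag_block_mat (map (\<lambda>i. one_hot_mat (cls i) (labs i)) is)"
  using assms
proof (induction "is")
  case Nil
  show ?case by (auto simp: one_hot_mat_def)
next
  case (Cons i "is")
  have IH: "one_hot_mat (concat (map cls is)) (concat (map labs is)) =
    diag_block_mat (map (\<lambda>i. one_hot_mat (cls i) (labs i)) is)"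
    using Cons.prems by (intro Cons.IH) (auto simp: disjoint_family_on_def)
  have "set (cls i) \<inter> set (concat (map cls is)) = {}"
    using Cons.prems(1,2) by (fastforce simp: disjoint_family_on_def)
  moreover have "set (concat (map labs is)) \<subseteq> set (concat (map cls is))"
    using Cons.prems(3) by fastforce
  ultimately have "one_hot_mat (concat (map cls (i # is))) (concat (map labs (i # is))) =
    four_block_mat (one_hot_mat (cls i) (labs i))
      (0\<^sub>m (length (labs i)) (length (concat (map cls is))))
      (0\<^sub>m (length (concat (map labs is))) (length (cls i)))
      (one_hot_mat (concat (map cls is)) (concat (map labs is)))"
    using Cons.prems(3)[of i] one_hot_mat_append[of "cls i" "concat (map cls is)" "labs i" "concat (map labs is)"]
    by simp
  moreover have "dim_row (one_hot_mat (concat (map cls is)) (concat (map labs is))) = length (concat (map labs is))"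
    "dim_col (one_hot_mat (concat (map cls is)) (concat (map labs is))) = length (concat (map cls is))"
    "dim_row (one_hot_mat (cls i) (labs i)) = length (labs i)"
    "dim_col (one_hot_mat (cls i) (labs i)) = length (cls i)"
    by (simp_all only: one_hot_mat_def dim_row_mat dim_col_mat)
  ultimately show ?case by (simp add: Let_def IH)
qed

end

theory Submission
  imports Defs "Jordan_Normal_Form.Determinant"
begin

text \<open>The joint kernel matrix is the Gram matrix of the feature rows, so the dual equation
  \<open>(K + \<lambda> I) \<alpha> = C\<close> says that the residual of \<open>W = \<Phi>\<^sup>T \<alpha>\<close> is \<open>\<lambda> \<alpha>\<close>. Consequently the first-order term of
  the objective at \<open>W\<close> vanishes in every direction, and the remaining quadratic terms are
  nonnegative.\<close>

section \<open>Ridge regression in an inner product space\<close>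

text \<open>Expand both squares around \<open>w0\<close> in the direction \<open>d = w - w0\<close>.
  The data term contributes \<open>- 2 * (lam * inner w0 d)\<close>, the penalty contributes the
  same with a plus sign, and what is left beyond the value at \<open>w0\<close> is a sum of squares
  plus \<open>lam * (norm d)\<^sup>2\<close>.\<close>

lemma ridge_column_minimal:
  fixes f :: "'i \<Rightarrow> 'h::real_inner" and y a :: "'i \<Rightarrow> real" and lam :: real
  assumes lam: "0 \<le> lam"
    and w0: "w0 = (\<Sum>j\<in>J. a j *\<^sub>R f j)"
    and residual: "\<And>j. j \<in> J \<Longrightarrow> y j - inner (f j) w0 = lam * a j"
  shows "(\<Sum>j\<in>J. (y j - inner (f j) w0)\<^sup>2) + lam * (norm w0)\<^sup>2
    \<le> (\<Sum>j\<in>J. (y j - inner (f j) w)\<^sup>2) + lam * (norm w)\<^sup>2"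
proof -
  define d where "d = w - w0"
  have w: "w = w0 + d" by (simp add: d_def)
  \<comment> \<open>Replacing each residual by \<open>lam * a j\<close> turns the sum into
    \<open>lam\<close> times the expansion of \<open>w0\<close> paired with \<open>d\<close>; this
    is the stationarity of the objective at \<open>w0\<close>.\<close>
  have cross: "(\<Sum>j\<in>J. (y j - inner (f j) w0) * inner (f j) d) = lam * inner w0 d"
  proof -
    have "inner w0 d = (\<Sum>j\<in>J. a j * inner (f j) d)" by (simp add: w0 inner_sum_left)
    then show ?thesis by (simp add: residual sum_distrib_left mult.assoc)
  qed
  have "(\<Sum>j\<in>J. (y j - inner (f j) w)\<^sup>2)
      = (\<Sum>j\<in>J. (y j - inner (f j) w0)\<^sup>2 + (inner (f j) d)\<^sup>2
          - 2 * ((y j - inner (f j) w0) * inner (f j) d))"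
    by (rule sum.cong) (simp_all add: w inner_add_right power2_eq_square algebra_simps)
  also have "\<dots> = (\<Sum>j\<in>J. (y j - inner (f j) w0)\<^sup>2) + (\<Sum>j\<in>J. (inner (f j) d)\<^sup>2)
      - 2 * (lam * inner w0 d)"
    by (simp add: sum.distrib sum_subtractf cross flip: sum_distrib_left)
  finally have data: "(\<Sum>j\<in>J. (y j - inner (f j) w)\<^sup>2) = \<dots>" .
  have "lam * (norm w)\<^sup>2 = lam * (norm w0)\<^sup>2 + 2 * (lam * inner w0 d) + lam * (norm d)\<^sup>2"
    by (simp add: w power2_norm_eq_inner inner_add_left inner_add_right inner_commute
        algebra_simps)
  moreover have "0 \<le> (\<Sum>j\<in>J. (inner (f j) d)\<^sup>2)" by (simp add: sum_nonneg)
  moreover have "0 \<le> lam * (norm d)\<^sup>2" using lam by simp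
  ultimately show ?thesis using data by linarith
qed

text \<open>Both squared Frobenius norms are sums over columns, so the problem over H^c decouples
  into one problem of the form treated in \<open>ridge_column_minimal\<close> for each
  class.\<close>

lemma ridge_objective_columns:
  assumes "Y \<in> carrier_mat (dim_vec F) (dim_vec W)"
  shows "ridge_objective lam Y F W =
    (\<Sum>l<dim_vec W. (\<Sum>j<dim_vec F. (Y $$ (j, l) - inner (F $ j) (W $ l))\<^sup>2)
      + lam * (norm (W $ l))\<^sup>2)"
proof -
  have "(frobenius_norm (Y - feature_mult F W))\<^sup>2 =
      (\<Sum>j<dim_vec F. \<Sum>l<dim_vec W. (Y $$ (j, l) - inner (F $ j) (W $ l))\<^sup>2)"
    using assms by (simp add: frobenius_norm_def feature_mult_def sum_nonneg)
  moreover have "(frobenius_norm_vec W)\<^sup>2 = (\<Sum>l<dim_vec W. (norm (W $ l))\<^sup>2)"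
    by (simp add: frobenius_norm_vec_def sum_nonneg)
  ultimately show ?thesis
    by (simp add: ridge_objective_def sum.distrib sum_distrib_left
        sum.swap[of _ "{..<dim_vec F}"])
qed

text \<open>This is the associativity law Phi (Phi^T \<alpha>) = (Phi Phi^T) \<alpha>. Reading the
  rows of \<open>F\<close> also as columns in H makes \<open>feature_mult F F\<close> the Gram
  matrix Phi Phi^T.\<close>

lemma feature_mult_transpose_mult:
  assumes "\<alpha> \<in> carrier_mat (dim_vec F) c"
  shows "feature_mult F (feature_transpose_mult F \<alpha>) = feature_mult F F * \<alpha>"
  using assms
  by (intro eq_matI)
    (auto simp: feature_mult_def feature_transpose_mult_def scalar_prod_def inner_sum_right
      lessThan_atLeast0 intro!: sum.cong)

text \<open>The dual equation is assumed in multiplied-out form, independently of how \<alpha> was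
  computed. Its Gram part is the prediction of the primal parameter, so the rest, \<open>lam\<close>
  times \<alpha>, is the residual required for each column.\<close>

lemma ridge_dual_solution_optimal:
  fixes F :: "'h::real_inner vec"
  assumes lam: "0 \<le> lam"
    and \<alpha>: "\<alpha> \<in> carrier_mat (dim_vec F) c"
    and dual: "(feature_mult F F + lam \<cdot>\<^sub>m 1\<^sub>m (dim_vec F)) * \<alpha> = Y"
  shows "is_arg_min (ridge_objective lam Y F) (\<lambda>W. W \<in> carrier_vec c)
    (feature_transpose_mult F \<alpha>)"
proof -
  let ?m = "dim_vec F" and ?W0 = "feature_transpose_mult F \<alpha>"
  have G: "feature_mult F F \<in> carrier_mat ?m ?m" by (simp add: feature_mult_def)
  have Y_eq: "Y = feature_mult F ?W0 + lam \<cdot>\<^sub>m \<alpha>"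
    using \<alpha> G
    by (simp add: dual[symmetric] feature_mult_transpose_mult[OF \<alpha>] add_mult_distrib_mat
        mult_smult_assoc_mat[of _ ?m ?m])
  have W0: "?W0 \<in> carrier_vec c" using \<alpha> by (auto simp: feature_transpose_mult_def)
  have Y: "Y \<in> carrier_mat ?m c" using \<alpha> W0 by (simp add: Y_eq feature_mult_def)
  have residual: "Y $$ (j, l) - inner (F $ j) (?W0 $ l) = lam * \<alpha> $$ (j, l)"
    if "j < ?m" "l < c" for j l
    using that \<alpha> W0 by (simp add: Y_eq feature_mult_def)
  have "ridge_objective lam Y F ?W0 \<le> ridge_objective lam Y F W" if W: "W \<in> carrier_vec c" for W
  proof -
    have "(\<Sum>j<?m. (Y $$ (j, l) - inner (F $ j) (?W0 $ l))\<^sup>2) + lam * (norm (?W0 $ l))\<^sup>2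
        \<le> (\<Sum>j<?m. (Y $$ (j, l) - inner (F $ j) (W $ l))\<^sup>2) + lam * (norm (W $ l))\<^sup>2"
      if l: "l < c" for l
    proof -
      have w0: "?W0 $ l = (\<Sum>j<?m. \<alpha> $$ (j, l) *\<^sub>R F $ j)"
        using l \<alpha> by (simp add: feature_transpose_mult_def)
      show ?thesis
        using l residual by (intro ridge_column_minimal[OF lam w0]) auto
    qed
    then show ?thesis
      using W W0 Y by (auto simp: ridge_objective_columns intro!: sum_mono)
  qed
  \<comment> \<open>\<open>is_arg_min\<close> says that no admissible point has a strictly smaller
    value; in the linear order of the reals this is the inequality just shown.\<close>
  then show ?thesis using W0 by (auto simp: is_arg_min_linorder)
qed

section \<open>Kernel matrices and invertibility after regularization\<close>

lemma kernel_mat_eq_feature_mult: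
  assumes "\<And>x y. x \<in> carrier_vec p \<Longrightarrow> y \<in> carrier_vec p \<Longrightarrow> k x y = inner (\<phi> x) (\<phi> y)"
    and "A \<in> carrier_mat m p"
  shows "kernel_mat k A A = feature_mult (feature_rows \<phi> A) (feature_rows \<phi> A)"
  using assms(2)
  by (intro eq_matI) (auto simp: kernel_mat_def feature_mult_def feature_rows_def assms(1))

text \<open>A nonzero \<open>v\<close> in the null space would give
  \<open>v \<bullet> (G *\<^sub>v v) + lam * (v \<bullet> v) = 0\<close>, although the first summand
  is nonnegative and the second positive.\<close>

lemma det_pos_semidef_add_smult_one_nonzero:
  assumes G: "pos_semidef_mat G" "G \<in> carrier_mat m m" and lam: "0 < lam"
  shows "det (G + lam \<cdot>\<^sub>m 1\<^sub>m m) \<noteq> 0"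
proof
  assume "det (G + lam \<cdot>\<^sub>m 1\<^sub>m m) = 0"
  then obtain v where v: "v \<in> carrier_vec m" "v \<noteq> 0\<^sub>v m"
    and zero: "(G + lam \<cdot>\<^sub>m 1\<^sub>m m) *\<^sub>v v = 0\<^sub>v m"
    using G det_0_iff_vec_prod_zero[of "G + lam \<cdot>\<^sub>m 1\<^sub>m m" m] by auto
  have "(lam \<cdot>\<^sub>m 1\<^sub>m m) *\<^sub>v v = lam \<cdot>\<^sub>v v"
    using v by (auto intro!: eq_vecI)
  then have "0\<^sub>v m = G *\<^sub>v v + lam \<cdot>\<^sub>v v"
    using v G zero by (simp add: add_mult_distrib_mat_vec[of _ m m])
  then have "v \<bullet> 0\<^sub>v m = v \<bullet> (G *\<^sub>v v + lam \<cdot>\<^sub>v v)" by simp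
  also have "\<dots> = v \<bullet> (G *\<^sub>v v) + lam * (v \<bullet> v)"
    using v G by (subst scalar_prod_add_distrib[of _ m]) auto
  finally have "v \<bullet> (G *\<^sub>v v) + lam * (v \<bullet> v) = 0" using v by simp
  moreover have "0 \<le> v \<bullet> (G *\<^sub>v v)" using G v by (auto simp: pos_semidef_mat_def)
  moreover have "0 < v \<bullet> v"
    \<comment> \<open>Conjugation is the identity on real vectors, so positivity of the conjugate
      scalar product applies directly.\<close>
    using v conjugate_square_greater_0_vec[of v m] by simp
  ultimately show False using lam by (smt (verit) mult_pos_pos)
qed

text \<open>A nonzero determinant makes \<open>A\<close> a unit and thereby excludes the result
  \<open>None\<close>; hence \<open>the\<close> in the formula for \<alpha> yields a genuine
  two-sided inverse.\<close>

lemma mat_inverse_nonzero_det: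
  assumes A: "(A :: 'a::field mat) \<in> carrier_mat n n" and "det A \<noteq> 0"
  obtains B where "mat_inverse A = Some B" "B \<in> carrier_mat n n" "A * B = 1\<^sub>m n" "B * A = 1\<^sub>m n"
  using mat_inverse[OF A] det_non_zero_imp_unit[OF A assms(2)] by (metis not_None_eq)

section \<open>Recursive block forms of the joint data\<close>

lemma mat_of_rows_append:
  assumes "set us \<subseteq> carrier_vec n" "set vs \<subseteq> carrier_vec n"
  shows "mat_of_rows n (us @ vs) = mat_of_rows n us @\<^sub>r mat_of_rows n vs"
  using assms by (intro eq_matI) (auto simp: append_rows_def mat_of_rows_def nth_append)

lemma row_append_rows:
  assumes "A \<in> carrier_mat a p" "B \<in> carrier_mat b p" "i < a + b"
  shows "row (A @\<^sub>r B) i = (if i < a then row A i else row B (i - a))"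
proof (cases "i < a")
  case True
  then show ?thesis using assms by (intro eq_vecI) (simp_all add: append_rows_def)
next
  case False
  then show ?thesis using assms by (intro eq_vecI) (simp_all add: append_rows_def)
qed

text \<open>Symmetry of \<open>k\<close> is what allows the upper right block to be the transpose of
  the lower left one, as in the recursion for \<open>K\<close>.\<close>

lemma kernel_mat_append_rows:
  assumes sym: "\<And>x y. x \<in> carrier_vec p \<Longrightarrow> y \<in> carrier_vec p \<Longrightarrow> k x y = k y x"
    and A: "A \<in> carrier_mat a p" and B: "B \<in> carrier_mat b p"
  shows "kernel_mat k (A @\<^sub>r B) (A @\<^sub>r B) =
    four_block_mat (kernel_mat k A A) (transpose_mat (kernel_mat k B A))
      (kernel_mat k B A) (kernel_mat k B B)"
proof -
  have "dim_row (A @\<^sub>r B) = a + b" using carrier_append_rows[OF A B] by blast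
  then show ?thesis
    using A B
    by (intro eq_matI)
      (auto simp: kernel_mat_def row_append_rows[OF A B] intro!: sym)
qed

lemma joint_features_Suc:
  assumes "\<And>i. i \<in> {1..Suc n} \<Longrightarrow> X i \<in> carrier_mat (Ns i) p"
  shows "joint_features p X (Suc n) = joint_features p X n @\<^sub>r X (Suc n)"
proof -
  have row: "x \<in> carrier_vec p" if "x \<in> set (rows (X i))" "1 \<le> i" "i \<le> Suc n" for i x
    using assms[of i] that by (auto simp: rows_def)
  have "set (concat (map (\<lambda>i. rows (X i)) [1..<Suc n])) \<subseteq> carrier_vec p"
    "set (rows (X (Suc n))) \<subseteq> carrier_vec p"
    by (auto simp del: upt_Suc intro: row)
  moreover have "dim_col (X (Suc n)) = p" using assms[of "Suc n"] by auto
  moreover have "[1..<Suc (Suc n)] = [1..<Suc n] @ [Suc n]" by simp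
  ultimately show ?thesis
    using mat_of_rows_rows[of "X (Suc n)"]
    by (simp add: joint_features_def mat_of_rows_append del: upt_Suc)
qed

lemma joint_features_carrier:
  assumes "\<And>i. i \<in> {1..n} \<Longrightarrow> X i \<in> carrier_mat (Ns i) p"
  shows "joint_features p X n \<in> carrier_mat (\<Sum>i=1..n. Ns i) p"
  using assms
proof (induction n)
  case 0
  show ?case by (auto simp: joint_features_def intro!: carrier_matI)
next
  case (Suc n)
  have "joint_features p X n @\<^sub>r X (Suc n) \<in> carrier_mat ((\<Sum>i=1..n. Ns i) + Ns (Suc n)) p"
    by (rule carrier_append_rows[OF Suc.IH]) (auto intro: Suc.prems)
  moreover have "joint_features p X (Suc n) = joint_features p X n @\<^sub>r X (Suc n)"
    using Suc.prems by (rule joint_features_Suc)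
  ultimately show ?case by simp
qed

text \<open>\<open>diag_block_mat\<close> is defined by splitting off the first block, whereas
  \<open>C\<close> grows at the lower right; \<open>diag_block_mat_last\<close> reconciles the
  two.\<close>

lemma joint_labels_Suc:
  "joint_labels Y (Suc n) =
    four_block_mat (joint_labels Y n) (0\<^sub>m (dim_row (joint_labels Y n)) (dim_col (Y (Suc n))))
      (0\<^sub>m (dim_row (Y (Suc n))) (dim_col (joint_labels Y n))) (Y (Suc n))"
proof -
  have "[1..<Suc (Suc n)] = [1..<Suc n] @ [Suc n]" by simp
  then show ?thesis
    by (simp only: joint_labels_def map_append list.map diag_block_mat_last Let_def)
qed

lemma joint_labels_carrier:
  assumes "\<And>i. i \<in> {1..n} \<Longrightarrow> Y i \<in> carrier_mat (Ns i) (c i)"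
  shows "joint_labels Y n \<in> carrier_mat (\<Sum>i=1..n. Ns i) (\<Sum>i=1..n. c i)"
  using assms
proof (induction n)
  case 0
  show ?case by (simp add: joint_labels_def)
next
  case (Suc n)
  then show ?case by (simp add: joint_labels_Suc)
qed

theorem theorem2:
  fixes lam :: real
    and p N :: nat
    and k :: "real vec \<Rightarrow> real vec \<Rightarrow> real"
    and \<phi> :: "real vec \<Rightarrow> 'h::{real_inner, complete_space}"
    and Ns c :: "nat \<Rightarrow> nat"
    and X Y K C M \<alpha> :: "nat \<Rightarrow> real mat"
    and cls labs :: "nat \<Rightarrow> 'l list"
  assumes lam: "0 < lam"
    and kernel: "pos_def_kernel p k"
    and feature_map:
      "\<And>x y. x \<in> carrier_vec p \<Longrightarrow> y \<in> carrier_vec p \<Longrightarrow> k x y = inner (\<phi> x) (\<phi> y)"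
    and N: "2 \<le> N"
    and X: "\<And>i. i \<in> {1..N} \<Longrightarrow> X i \<in> carrier_mat (Ns i) p"
    and classes: "\<And>i. i \<in> {1..N} \<Longrightarrow> distinct (cls i) \<and> length (cls i) = c i"
    and labels: "\<And>i. i \<in> {1..N} \<Longrightarrow> length (labs i) = Ns i \<and> set (labs i) \<subseteq> set (cls i)"
    and disjoint: "disjoint_family_on (\<lambda>i. set (cls i)) {1..N}"
    and Y: "\<And>i. i \<in> {1..N} \<Longrightarrow> Y i = one_hot_mat (cls i) (labs i)"
    and M_1: "M 1 = X 1"
    and K_1: "K 1 = kernel_mat k (X 1) (X 1)"
    and C_1: "C 1 = Y 1"
    and K_rec: "\<And>n. n \<in> {2..N} \<Longrightarrow> K n =
      four_block_mat
        (K (n - 1))                       (transpose_mat (kernel_mat k (X n) (M (n - 1))))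
        (kernel_mat k (X n) (M (n - 1)))  (kernel_mat k (X n) (X n))"
    and C_rec: "\<And>n. n \<in> {2..N} \<Longrightarrow> C n =
      four_block_mat
        (C (n - 1))                                       (0\<^sub>m (dim_row (C (n - 1))) (dim_col (Y n)))
        (0\<^sub>m (dim_row (Y n)) (dim_col (C (n - 1))))  (Y n)"
    and M_rec: "\<And>n. n \<in> {2..N} \<Longrightarrow> M n = M (n - 1) @\<^sub>r X n"
    and alpha: "\<And>n. n \<in> {2..N} \<Longrightarrow>
      \<alpha> n = the (mat_inverse (K n + lam \<cdot>\<^sub>m 1\<^sub>m (dim_row (K n)))) * C n"
  shows "\<forall>n \<in> {2..N}.
    invertible_mat (K n + lam \<cdot>\<^sub>m 1\<^sub>m (dim_row (K n))) \<and>
    \<alpha> n \<in> carrier_mat (\<Sum>i=1..n. Ns i) (\<Sum>i=1..n. c i) \<and>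
    is_arg_min
      (ridge_objective lam (joint_labels Y n) (feature_rows \<phi> (joint_features p X n)))
      (\<lambda>W. W \<in> carrier_vec (\<Sum>i=1..n. c i))
      (feature_transpose_mult (feature_rows \<phi> (joint_features p X n)) (\<alpha> n))"
proof
  fix n
  assume n: "n \<in> {2..N}"
  have sym: "k x y = k y x" if "x \<in> carrier_vec p" "y \<in> carrier_vec p" for x y
    using kernel that by (auto simp: pos_def_kernel_def)
  \<comment> \<open>The invariant of the recursion. The three claims are carried together because
    the step for \<open>K\<close> needs \<open>M i\<close> as well; the induction starts at 1, where
    the initial values are given.\<close>
  have "M i = joint_features p X i \<and> K i = kernel_mat k (M i) (M i) \<and> C i = joint_labels Y i"
    if "1 \<le> i" "i \<le> N" for i
    using that
  proof (induction i rule: nat_induct_at_least)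
    case base
    have "mat_of_rows p (rows (X 1)) = X 1"
      using X[of 1] N mat_of_rows_rows[of "X 1"] by auto
    moreover have "[1..<Suc 1] = [1]" by simp
    ultimately show ?case
      by (simp only: M_1 K_1 C_1 joint_features_def joint_labels_def list.map concat.simps
          append_Nil2 diag_block_mat_singleton)
  next
    case (Suc i)
    then have i: "Suc i \<in> {2..N}" and
      IH: "M i = joint_features p X i" "K i = kernel_mat k (M i) (M i)" "C i = joint_labels Y i"
      by auto
    have "X j \<in> carrier_mat (Ns j) p" if "j \<in> {1..Suc i}" for j using X that i by auto
    then have M_Suc: "M (Suc i) = joint_features p X (Suc i)"
      using M_rec[OF i] IH joint_features_Suc[of i X Ns p] by simp
    have "M i \<in> carrier_mat (\<Sum>j=1..i. Ns j) p"
      unfolding IH using X i by (intro joint_features_carrier) auto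
    moreover have "X (Suc i) \<in> carrier_mat (Ns (Suc i)) p" using X i by auto
    \<comment> \<open>The recursive block matrix is exactly the kernel matrix of the old memory with
      the new features appended below.\<close>
    ultimately have "K (Suc i) = kernel_mat k (M (Suc i)) (M (Suc i))"
      using K_rec[OF i] M_rec[OF i] by (simp add: IH(2) kernel_mat_append_rows[OF sym])
    moreover have "C (Suc i) = joint_labels Y (Suc i)"
      using C_rec[OF i] by (simp add: IH(3) joint_labels_Suc)
    ultimately show ?case using M_Suc by blast
  qed
  then have M_n: "M n = joint_features p X n" and K_n: "K n = kernel_mat k (M n) (M n)"
    and C_n: "C n = joint_labels Y n"
    using n by auto
  define m where "m = (\<Sum>i=1..n. Ns i)"
  define F where "F = feature_rows \<phi> (M n)"
  have M_carrier: "M n \<in> carrier_mat m p"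
    unfolding M_n m_def using X n by (intro joint_features_carrier) auto
  have K_carrier: "K n \<in> carrier_mat m m" using M_carrier by (simp add: K_n kernel_mat_def)
  have C_carrier: "C n \<in> carrier_mat m (\<Sum>i=1..n. c i)"
    unfolding C_n m_def
    using n classes labels by (intro joint_labels_carrier) (auto simp: Y one_hot_mat_def)
  have F_dim: "dim_vec F = m" using M_carrier by (simp add: F_def feature_rows_def)
  \<comment> \<open>The same matrix is now seen in two ways: as a kernel matrix it is positive
    semidefinite, which gives invertibility, and as a Gram matrix in H it enters the optimality
    argument.\<close>
  have K_F: "K n = feature_mult F F"
    unfolding K_n F_def by (rule kernel_mat_eq_feature_mult[OF feature_map M_carrier])
  define A where "A = K n + lam \<cdot>\<^sub>m 1\<^sub>m (dim_row (K n))"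
  have A_eq: "A = K n + lam \<cdot>\<^sub>m 1\<^sub>m m" and A_carrier: "A \<in> carrier_mat m m"
    using K_carrier by (auto simp: A_def)
  have "pos_semidef_mat (K n)" using kernel M_carrier by (auto simp: pos_def_kernel_def K_n)
  then have "det A \<noteq> 0"
    unfolding A_eq using K_carrier lam by (rule det_pos_semidef_add_smult_one_nonzero)
  then obtain B where B: "mat_inverse A = Some B" "B \<in> carrier_mat m m" "A * B = 1\<^sub>m m" "B * A = 1\<^sub>m m"
    using mat_inverse_nonzero_det[OF A_carrier] by blast
  have invertible: "invertible_mat A"
    using A_carrier B by (auto simp: invertible_mat_def inverts_mat_def)
  have \<alpha>_eq: "\<alpha> n = B * C n" using alpha[OF n] B by (simp add: A_def)
  have \<alpha>_carrier: "\<alpha> n \<in> carrier_mat m (\<Sum>i=1..n. c i)" using B C_carrier by (simp add: \<alpha>_eq)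
  \<comment> \<open>Multiplying by \<open>A\<close> turns the inverse formula for \<alpha> into the
    dual equation, with \<open>C n\<close> as the joint label matrix.\<close>
  have "A * \<alpha> n = A * B * C n"
    unfolding \<alpha>_eq using A_carrier B(2) C_carrier by (simp add: assoc_mult_mat[of _ m m _ m])
  then have "A * \<alpha> n = C n" using B C_carrier by simp
  then have "is_arg_min (ridge_objective lam (C n) F) (\<lambda>W. W \<in> carrier_vec (\<Sum>i=1..n. c i))
      (feature_transpose_mult F (\<alpha> n))"
    using lam \<alpha>_carrier by (intro ridge_dual_solution_optimal) (simp_all add: A_eq K_F F_dim)
  then show "invertible_mat (K n + lam \<cdot>\<^sub>m 1\<^sub>m (dim_row (K n))) \<and>
    \<alpha> n \<in> carrier_mat (\<Sum>i=1..n. Ns i) (\<Sum>i=1..n. c i) \<and>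
    is_arg_min
      (ridge_objective lam (joint_labels Y n) (feature_rows \<phi> (joint_features p X n)))
      (\<lambda>W. W \<in> carrier_vec (\<Sum>i=1..n. c i))
      (feature_transpose_mult (feature_rows \<phi> (joint_features p X n)) (\<alpha> n))"
    using invertible \<alpha>_carrier unfolding A_def m_def F_def C_n M_n by blast
qed

end
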